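(* For all $\epsilon\in(0,1]$ and $\alpha\in(0,1/2]$, there exists an $\alpha$-accurate $\epsilon$-differentially private (pure DP) sampler for the class $\mathcal{D}^{\mathrm{prod}}=\{\mathsf{Ber}(p_1)\otimes\cdots\otimes\mathsf{Ber}(p_d)\mid p_1,\dots,p_d\in[0,1]\}$ of product distributions on $\{0,1\}^d$ with sample complexity $$O\left(\frac{d\log(d/\alpha)}{\alpha\epsilon}+\frac{d\log^2(d/\alpha)}{\epsilon}\right).$$
   Context: $\mathsf{Ber}(p)$ is the distribution on $\{0,1\}$ with mass $p$ at $1$; $\otimes$ denotes product of independent coordinates. A sampler with sample complexity $n$ for a class $\mathcal{D}$ is an algorithm $\mathcal{A}$ that receives $n$ i.i.d. samples $\mathbf{X}\sim D^n$ from an unknown $D\in\mathcal{D}$ and outputs one element of the domain; with $Q_{\mathcal{A},D}$ the distribution of $\mathcal{A}(\mathbf{X})$, it is $\alpha$-accurate if $d_{\mathrm{tv}}(D,Q_{\mathcal{A},D})\le\alpha$ for all $D\in\mathcal{D}$. Datasets are neighbors if they have the same size and differ in one element. $\mathcal{M}$ is $\epsilon$-DP if for all neighbors $Y,Y'$ and all output sets $S$, $\Pr[\mathcal{M}(Y)\in S]\le e^\epsilon\Pr[\mathcal{M}(Y')\in S]$. *)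

theory Defs
  imports "HOL-Probability.Probability" "HOL-Probability.Product_PMF"
begin

(* Everything below lives on a finite domain X, so discrete distributions (pmfs) suffice.
   A dataset is an ordered list of n records. *)

definition datasets :: "'a set \<Rightarrow> nat \<Rightarrow> 'a list set" where
  "datasets X n = {Y. length Y = n \<and> set Y \<subseteq> X}"

definition neighbors :: "'a list \<Rightarrow> 'a list \<Rightarrow> bool" where
  "neighbors Y Y' \<longleftrightarrow> length Y = length Y' \<and> card {i. i < length Y \<and> Y ! i \<noteq> Y' ! i} = 1"

definition pure_dp :: "real \<Rightarrow> 'a set \<Rightarrow> nat \<Rightarrow> ('a list \<Rightarrow> 'b pmf) \<Rightarrow> bool" where
  "pure_dp \<epsilon> X n M \<longleftrightarrow>
     (\<forall>Y \<in> datasets X n. \<forall>Y' \<in> datasets X n. neighbors Y Y' \<longrightarrow>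
        (\<forall>S. measure_pmf.prob (M Y) S \<le> exp \<epsilon> * measure_pmf.prob (M Y') S))"

definition dtv :: "'a pmf \<Rightarrow> 'a pmf \<Rightarrow> real" where
  "dtv P Q = (SUP S. \<bar>measure_pmf.prob P S - measure_pmf.prob Q S\<bar>)"

(* A randomized algorithm is a map from datasets to output distributions. *)
definition sampler :: "'a set \<Rightarrow> nat \<Rightarrow> ('a list \<Rightarrow> 'a pmf) \<Rightarrow> bool" where
  "sampler X n A \<longleftrightarrow> (\<forall>Y \<in> datasets X n. set_pmf (A Y) \<subseteq> X)"

definition output_dist :: "nat \<Rightarrow> ('a list \<Rightarrow> 'a pmf) \<Rightarrow> 'a pmf \<Rightarrow> 'a pmf" where
  "output_dist n A D = bind_pmf (replicate_pmf n D) A"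

definition accurate :: "real \<Rightarrow> 'a pmf set \<Rightarrow> nat \<Rightarrow> ('a list \<Rightarrow> 'a pmf) \<Rightarrow> bool" where
  "accurate \<alpha> \<D> n A \<longleftrightarrow> (\<forall>D \<in> \<D>. dtv D (output_dist n A D) \<le> \<alpha>)"

(* Points of {0,1}^d are functions nat => bool (True for 1) on the indices below d,
   with the junk value False elsewhere. *)
definition cube :: "nat \<Rightarrow> (nat \<Rightarrow> bool) set" where
  "cube d = PiE_dflt {..<d} False (\<lambda>_. UNIV)"

definition product_class :: "nat \<Rightarrow> (nat \<Rightarrow> bool) pmf set" where
  "product_class d =
     {Pi_pmf {..<d} False (\<lambda>i. bernoulli_pmf (p i)) | p. \<forall>i<d. p i \<in> {0..1::real}}"

end

theory Submission
  imports Defs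
begin

text \<open>Smooth the empirical marginals of \<open>X\<close> away from 0 and 1 by \<open>\<delta> = \<alpha> / (4 * d)\<close> and let \<open>F X\<close> be the product
  distribution with these marginals. As \<open>pmf (F X) y\<close> is a product of affine functions of independent
  columns, \<open>F X\<close> averages over i.i.d. data to the product with smoothed true marginals, which is
  within \<open>O (d * \<delta>)\<close> of the unknown distribution.

  \<open>F\<close> itself is not private, so it is replaced by the normalised Lipschitz extension
  \<open>M X y \<sim> min\<^sub>Z exp (\<epsilon> / 2 * ham X Z) * F Z y\<close>, which is \<open>\<epsilon>\<close>-private unconditionally. It remains to show that
  on typical data \<open>X\<close> the minimum is almost attained at \<open>Z = X\<close>. Replacing the records in a set \<open>T\<close>
  changes \<open>ln (F X y)\<close> by at most \<open>1 / n\<close> times the sum over \<open>j \<in> T\<close> of the weights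
  \<open>\<Sum>i. (1 + ln (q / \<delta>)) / q\<close>, where \<open>q\<close> is the smoothed frequency of bit \<open>i\<close> of record \<open>j\<close>. A random record has
  weight \<open>O (ln (1 / \<delta>) / \<delta>)\<close> up to an exponential tail, so \<open>n\<close> of order \<open>ln (1 / \<delta>) / (\<delta> * \<epsilon>)\<close> suffices. The excess
  over this bound is only needed on average over the records, so that no union bound over \<open>n\<close>, hence
  no factor \<open>ln (1 / \<epsilon>)\<close>, appears.\<close>

section \<open>Expectations over finitely supported distributions and i.i.d. samples\<close>

abbreviation expect :: "'a pmf \<Rightarrow> ('a \<Rightarrow> real) \<Rightarrow> real"
  where "expect p f \<equiv> measure_pmf.expectation p f"

lemma integrable_finite_pmf [simp]:
  fixes f :: "'a \<Rightarrow> real"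
  shows "finite (set_pmf p) \<Longrightarrow> integrable (measure_pmf p) f"
  by (rule integrable_measure_pmf_finite)

lemma expectation_mono_pmf:
  fixes f g :: "'a \<Rightarrow> real"
  assumes "finite (set_pmf p)" "\<And>x. x \<in> set_pmf p \<Longrightarrow> f x \<le> g x"
  shows "expect p f \<le> expect p g"
  using assms by (intro integral_mono_AE) (auto simp: AE_measure_pmf_iff)

lemma finite_set_replicate_pmf [simp]:
  "finite (set_pmf p) \<Longrightarrow> finite (set_pmf (replicate_pmf n p))"
  unfolding set_replicate_pmf by (simp add: finite_lists_length_eq lists_eq_set)

lemma expectation_replicate_Suc:
  fixes f :: "'a list \<Rightarrow> real"
  assumes "finite (set_pmf p)"
  shows "expect (replicate_pmf (Suc n) p) f
       = expect p (\<lambda>x. expect (replicate_pmf n p) (\<lambda>xs. f (x # xs)))"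
proof -
  have "expect (replicate_pmf (Suc n) p) f
      = (\<Sum>x\<in>set_pmf p. pmf p x * expect (map_pmf ((#) x) (replicate_pmf n p)) f)"
    using assms unfolding replicate_pmf.simps map_pmf_def[symmetric]
    by (subst pmf_expectation_bind[of "set_pmf p"]) auto
  also have "\<dots> = expect p (\<lambda>x. expect (replicate_pmf n p) (\<lambda>xs. f (x # xs)))"
    using assms by (subst integral_measure_pmf_real[of "set_pmf p"]) (auto simp: mult.commute)
  finally show ?thesis .
qed

lemma expectation_replicate_sum:
  assumes "finite (set_pmf p)"
  shows "expect (replicate_pmf n p) (\<lambda>xs. \<Sum>j<n. f (xs ! j)) = real n * expect p f"
proof (induction n)
  case (Suc n)
  show ?case
    unfolding expectation_replicate_Suc[OF assms] sum.lessThan_Suc_shift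
    using assms Suc by (simp add: algebra_simps)
qed simp

lemma expectation_replicate_prod:
  fixes f :: "'a \<Rightarrow> real"
  assumes "finite (set_pmf p)"
  shows "expect (replicate_pmf n p) (\<lambda>xs. \<Prod>j<n. f (xs ! j)) = expect p f ^ n"
proof (induction n)
  case (Suc n)
  show ?case
    unfolding expectation_replicate_Suc[OF assms] prod.lessThan_Suc_shift
    using assms Suc by simp
qed simp

lemma finite_set_Pi_bool_pmf [simp]:
  fixes P :: "nat \<Rightarrow> bool pmf"
  shows "finite (set_pmf (Pi_pmf {..<d} False P))"
  by (rule finite_subset[OF set_Pi_pmf_subset']) auto

text \<open>Induction on the number of records. The first record \<open>x\<close> adds
  \<open>g i (x i)\<close> to the offset of column \<open>i\<close>, so \<open>a\<close> must be
  arbitrary in the induction. After averaging over the other records, factor \<open>i\<close>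
  depends on \<open>x\<close> through \<open>x i\<close> only, and independence of the coordinates
  splits the expectation of the product.\<close>

lemma expectation_prod_columns:
  fixes P :: "nat \<Rightarrow> bool pmf" and a :: "nat \<Rightarrow> real"
  assumes "\<And>i. i < d \<Longrightarrow> a i \<ge> 0" "\<And>i b. i < d \<Longrightarrow> g i b \<ge> 0"
  shows "expect (replicate_pmf n (Pi_pmf {..<d} False P))
           (\<lambda>xs. \<Prod>i<d. a i + (\<Sum>j<n. g i ((xs ! j) i)))
       = (\<Prod>i<d. a i + real n * expect (P i) (g i))"
  using assms(1)
proof (induction n arbitrary: a)
  case (Suc n)
  let ?D = "Pi_pmf {..<d} False P"
  have pos: "expect (P i) (g i) \<ge> 0" if "i < d" for i
    using that assms(2) by (intro integral_nonneg_AE) auto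
  have "expect (replicate_pmf (Suc n) ?D) (\<lambda>xs. \<Prod>i<d. a i + (\<Sum>j<Suc n. g i ((xs ! j) i)))
      = expect ?D (\<lambda>x. expect (replicate_pmf n ?D)
          (\<lambda>xs. \<Prod>i<d. (a i + g i (x i)) + (\<Sum>j<n. g i ((xs ! j) i))))"
    unfolding expectation_replicate_Suc[OF finite_set_Pi_bool_pmf] sum.lessThan_Suc_shift
    by (simp add: add.assoc)
  also have "\<dots> = expect ?D (\<lambda>x. \<Prod>i<d. (a i + real n * expect (P i) (g i)) + g i (x i))"
    by (subst Suc.IH) (use Suc.prems assms(2) in \<open>auto simp: add_ac intro!: add_nonneg_nonneg\<close>)
  also have "\<dots> = (\<Prod>i<d. expect (P i) (\<lambda>b. (a i + real n * expect (P i) (g i)) + g i b))"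
    by (rule expectation_prod_Pi_pmf)
       (use Suc.prems assms(2) pos in \<open>auto intro!: add_nonneg_nonneg\<close>)
  also have "\<dots> = (\<Prod>i<d. a i + real (Suc n) * expect (P i) (g i))"
    by (intro prod.cong) (auto simp: algebra_simps)
  finally show ?case .
qed simp

section \<open>Total variation distance and the private extension\<close>

text \<open>A one-sided bound suffices: passing from \<open>S\<close> to its complement flips the
  sign of the difference.\<close>

lemma dtv_le:
  assumes "\<And>S. measure_pmf.prob P S \<le> measure_pmf.prob Q S + a"
  shows "dtv P Q \<le> a"
  unfolding dtv_def
proof (rule cSUP_least)
  fix S
  show "\<bar>measure_pmf.prob P S - measure_pmf.prob Q S\<bar> \<le> a"
    using assms[of S] assms[of "- S"] measure_pmf.prob_compl[of S P] measure_pmf.prob_compl[of S Q]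
    by (simp add: Compl_eq_Diff_UNIV)
qed simp

text \<open>The infimum over all \<open>X'\<close> of \<open>exp (c * h X X') * F X'\<close> is \<open>c\<close>-Lipschitz in \<open>X\<close> and has total mass at
  most 1, so normalising it costs at most another factor \<open>exp (c * h X X')\<close> and can only increase it.\<close>
lemma lipschitz_extension:
  fixes F :: "'x \<Rightarrow> 'y pmf" and h :: "'x \<Rightarrow> 'x \<Rightarrow> real"
  assumes fin: "finite \<X>" "\<X> \<noteq> {}" "finite \<Omega>"
    and supp: "\<And>X. X \<in> \<X> \<Longrightarrow> set_pmf (F X) = \<Omega>"
    and tri: "\<And>X Y Z. h X Z \<le> h X Y + h Y Z" and sym: "\<And>X Y. h X Y = h Y X"
    and refl: "\<And>X. h X X = 0" and c: "c \<ge> 0"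
  obtains M where "\<And>X. set_pmf (M X) \<subseteq> \<Omega>"
    and "\<And>X Y y. pmf (M X) y \<le> exp (2 * c * h X Y) * pmf (M Y) y"
    and "\<And>X y l. X \<in> \<X> \<Longrightarrow> \<forall>X'\<in>\<X>. l \<le> exp (c * h X X') * pmf (F X') y \<Longrightarrow> l \<le> pmf (M X) y"
proof -
  define g where "g X y = Min ((\<lambda>X'. exp (c * h X X') * pmf (F X') y) ` \<X>)" for X y
  define Z where "Z X = (\<Sum>y\<in>\<Omega>. g X y)" for X
  define M where "M X = embed_pmf (\<lambda>y. g X y / Z X)" for X
  obtain X0 where "X0 \<in> \<X>" using fin by auto
  then have Omega: "\<Omega> \<noteq> {}" using supp[of X0] set_pmf_not_empty[of "F X0"] by simp
  have g_ge: "l \<le> g X y" if "\<And>X'. X' \<in> \<X> \<Longrightarrow> l \<le> exp (c * h X X') * pmf (F X') y" for l X y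
    using fin that unfolding g_def by (subst Min_ge_iff) auto
  have g_le: "g X y \<le> exp (c * h X X') * pmf (F X') y" if "X' \<in> \<X>" for X X' y
    using fin that unfolding g_def by (intro Min_le) auto
  have g_nonneg: "g X y \<ge> 0" for X y by (rule g_ge) simp
  \<comment> \<open>The common full support makes this minimum positive, so the normaliser
    \<open>Z\<close> cannot vanish.\<close>
  have g_pos: "g X y > 0" if "y \<in> \<Omega>" for X y
  proof -
    have "pmf (F X') y > 0" if "X' \<in> \<X>" for X'
      using supp[OF that] \<open>y \<in> \<Omega>\<close> by (intro pmf_positive) simp
    then show ?thesis using fin unfolding g_def by (subst Min_gr_iff) auto
  qed
  have g_out: "g X y = 0" if "y \<notin> \<Omega>" for X y
  proof -
    obtain X' where "X' \<in> \<X>" using fin by auto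
    moreover have "pmf (F X') y = 0" using that supp[OF \<open>X' \<in> \<X>\<close>] by (simp add: pmf_eq_0_set_pmf)
    ultimately have "g X y \<le> 0" using g_le[of X' X y] by simp
    with g_nonneg[of X y] show ?thesis by simp
  qed
  have g_lip: "g X y \<le> exp (c * h X Y) * g Y y" for X Y y
  proof -
    have "exp (- (c * h X Y)) * g X y \<le> g Y y"
    proof (rule g_ge)
      fix X' assume X': "X' \<in> \<X>"
      have "exp (- (c * h X Y)) * g X y \<le> exp (- (c * h X Y)) * (exp (c * h X X') * pmf (F X') y)"
        using g_le[OF X'] by (intro mult_left_mono) auto
      also have "\<dots> = exp (c * (h X X' - h X Y)) * pmf (F X') y"
        by (simp add: right_diff_distrib exp_diff exp_minus field_simps)
      also have "\<dots> \<le> exp (c * h Y X') * pmf (F X') y"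
        using tri[of X X' Y] c by (intro mult_right_mono) (auto intro!: mult_left_mono)
      finally show "exp (- (c * h X Y)) * g X y \<le> exp (c * h Y X') * pmf (F X') y" .
    qed
    then show ?thesis by (simp add: exp_minus field_simps)
  qed
  have Z_pos: "Z X > 0" for X
    unfolding Z_def using fin Omega g_pos by (intro sum_pos) auto
  have Z_lip: "Z X \<le> exp (c * h X Y) * Z Y" for X Y
    unfolding Z_def sum_distrib_left by (intro sum_mono g_lip)
  have Z_le: "Z X \<le> 1" if "X \<in> \<X>" for X
  proof -
    have "Z X \<le> (\<Sum>y\<in>\<Omega>. pmf (F X) y)"
      unfolding Z_def using g_le[OF that, of X] refl by (intro sum_mono) simp
    also have "\<dots> = 1" using fin supp[OF that] by (intro sum_pmf_eq_1) auto
    finally show ?thesis .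
  qed
  have pmf_M: "pmf (M X) y = g X y / Z X" for X y
    unfolding M_def
  proof (rule pmf_embed_pmf)
    show "g X x / Z X \<ge> 0" for x using g_nonneg Z_pos[of X] by simp
    have "(\<integral>\<^sup>+x. ennreal (g X x / Z X) \<partial>count_space UNIV)
        = (\<Sum>x\<in>\<Omega>. ennreal (g X x / Z X))"
      using g_pos[of _ X] g_out[of _ X] Z_pos[of X] fin(3)
      by (intro nn_integral_count_space'[where A=\<Omega>]) auto
    also have "\<dots> = ennreal (\<Sum>x\<in>\<Omega>. g X x / Z X)"
      using g_nonneg Z_pos[of X] by (intro sum_ennreal) auto
    also have "(\<Sum>x\<in>\<Omega>. g X x / Z X) = 1"
      using Z_pos[of X] by (simp add: sum_divide_distrib[symmetric] Z_def[symmetric])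
    finally show "(\<integral>\<^sup>+x. ennreal (g X x / Z X) \<partial>count_space UNIV) = 1" by simp
  qed
  show ?thesis
  proof (rule that[of M])
    show "set_pmf (M X) \<subseteq> \<Omega>" for X
      using g_out[of _ X] by (fastforce simp: set_pmf_iff pmf_M)
    show "pmf (M X) y \<le> exp (2 * c * h X Y) * pmf (M Y) y" for X Y y
    proof -
      have "g X y / Z X \<le> (exp (c * h X Y) * g Y y) / (Z Y / exp (c * h X Y))"
        using g_lip[of X y Y] Z_lip[of Y X] Z_pos[of Y] g_nonneg[of Y y] sym[of Y X]
        by (intro frac_le) (auto simp: field_simps)
      also have "\<dots> = exp (2 * c * h X Y) * (g Y y / Z Y)"
        by (simp add: exp_double power2_eq_square mult.assoc)
      finally show ?thesis by (simp add: pmf_M)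
    qed
    show "l \<le> pmf (M X) y"
      if "X \<in> \<X>" "\<forall>X'\<in>\<X>. l \<le> exp (c * h X X') * pmf (F X') y" for X y l
    proof -
      have "l \<le> g X y" using that(2) by (intro g_ge) blast
      also have "\<dots> \<le> g X y / Z X"
        using g_nonneg[of X y] Z_pos[of X] Z_le[OF that(1)] by (simp add: divide_simps mult_left_le)
      finally show ?thesis by (simp add: pmf_M)
    qed
  qed
qed

section \<open>A slope for logarithms of frequencies bounded below\<close>

text \<open>If a frequency drops from \<open>q\<close> by \<open>t\<close> but stays above \<delta>,
  its logarithm drops by at most \<open>t * weight \<delta> q\<close>. The derivative
  \<open>1 / q\<close> alone only covers infinitesimal drops; the logarithmic factor pays for a fall
  all the way to \<delta>.\<close>

definition weight :: "real \<Rightarrow> real \<Rightarrow> real"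
  where "weight \<delta> q = (1 + ln (q / \<delta>)) / q"

lemma weight_nonneg: "0 < \<delta> \<Longrightarrow> \<delta> \<le> q \<Longrightarrow> 0 \<le> weight \<delta> q"
  by (simp add: weight_def)

text \<open>From \<open>p\<close> to \<open>q\<close> the numerator gains
  \<open>ln (q / p) \<le> q / p - 1\<close>. As the numerator at \<open>p\<close> is at least 1, its
  relative growth is at most that of the denominator.\<close>

lemma weight_antimono:
  assumes "0 < \<delta>" "\<delta> \<le> p" "p \<le> q"
  shows "weight \<delta> q \<le> weight \<delta> p"
proof -
  have "ln (q / \<delta>) = ln (p / \<delta>) + ln (q / p)" using assms by (simp add: ln_div)
  also have "ln (q / p) \<le> q / p - 1" using assms by (intro ln_le_minus_one) auto
  finally have "p * (1 + ln (q / \<delta>)) \<le> p * (1 + ln (p / \<delta>) + (q / p - 1))"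
    using assms by (intro mult_left_mono) auto
  also have "\<dots> = p * (1 + ln (p / \<delta>)) + (q - p)" using assms by (simp add: field_simps)
  also have "\<dots> \<le> p * (1 + ln (p / \<delta>)) + (q - p) * (1 + ln (p / \<delta>))"
    using assms by (simp add: mult_le_cancel_left1)
  also have "\<dots> = q * (1 + ln (p / \<delta>))" by (simp add: algebra_simps)
  finally show ?thesis using assms by (simp add: weight_def field_simps)
qed

lemma weight_le_inverse: "0 < \<delta> \<Longrightarrow> \<delta> \<le> q \<Longrightarrow> \<delta> * weight \<delta> q \<le> 1"
  using weight_antimono[of \<delta> \<delta> q] by (simp add: weight_def field_simps)

text \<open>Exchanges a random empirical frequency \<open>q\<close> for a fixed \<open>m\<close>. If
  \<open>q\<close> is below \<open>m\<close>, the numerator only shrinks, and the denominator loses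
  at most a factor 4.\<close>

lemma weight_le_4:
  assumes "0 < \<delta>" "\<delta> \<le> q" "\<delta> \<le> m" "m / 4 \<le> q"
  shows "weight \<delta> q \<le> 4 * weight \<delta> m"
proof (cases "m \<le> q")
  case True
  then show ?thesis using weight_antimono[of \<delta> m q] weight_nonneg[of \<delta> m] assms by linarith
next
  case False
  have "(1 + ln (q / \<delta>)) / q \<le> (1 + ln (m / \<delta>)) / (m / 4)"
    using assms False by (intro frac_le) (auto simp: divide_right_mono intro!: add_nonneg_nonneg)
  then show ?thesis by (simp add: weight_def mult.commute)
qed

text \<open>With \<open>r = q / q'\<close> this is \<open>ln r \<le> (1 - 1 / r) * (1 + ln r)\<close>, a rearrangement of \<open>ln r \<le> r - 1\<close>.\<close>
lemma ratio_le_exp_weight: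
  assumes "0 < \<delta>" "\<delta> \<le> q" "\<delta> \<le> q'" "q \<le> q' + t" "0 \<le> t"
  shows "q \<le> q' * exp (t * weight \<delta> q)"
proof (cases "q \<le> q'")
  case True
  have "q' * 1 \<le> q' * exp (t * weight \<delta> q)"
    using assms weight_nonneg by (intro mult_left_mono) auto
  with True show ?thesis by simp
next
  case False
  define r where "r = q / q'"
  have r: "r > 1" "q = r * q'" using False assms by (auto simp: r_def)
  have "ln r \<le> r - 1" using r by (intro ln_le_minus_one) auto
  then have "ln r \<le> (1 - 1 / r) * (1 + ln r)" using r by (simp add: field_simps)
  also have "\<dots> \<le> (1 - 1 / r) * (1 + ln (q / \<delta>))"
  proof (intro mult_left_mono add_left_mono)
    have "r \<le> q / \<delta>" unfolding r_def using assms by (intro divide_left_mono) auto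
    then show "ln r \<le> ln (q / \<delta>)" using r by (intro ln_mono) auto
    show "0 \<le> 1 - 1 / r" using r by simp
  qed
  also have "1 - 1 / r = (q - q') / q" using r assms by (simp add: field_simps)
  also have "(q - q') / q * (1 + ln (q / \<delta>)) = (q - q') * weight \<delta> q"
    by (simp add: weight_def)
  also have "\<dots> \<le> t * weight \<delta> q"
    using assms weight_nonneg[of \<delta> q] by (intro mult_right_mono) auto
  finally have "r \<le> exp (t * weight \<delta> q)" using r by (metis exp_le_cancel_iff exp_ln less_trans zero_less_one)
  then show ?thesis using r assms by (simp add: mult.commute)
qed

section \<open>The product distribution with smoothed empirical marginals\<close>

text \<open>The factor \<open>1 - 2 * \<delta>\<close> makes the values at \<open>True\<close> and
  \<open>False\<close> sum to 1. With the bit as an argument, the mass of a point \<open>y\<close>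
  is one product without case distinctions.\<close>

definition smoothed :: "real \<Rightarrow> nat \<Rightarrow> (nat \<Rightarrow> bool) list \<Rightarrow> nat \<Rightarrow> bool \<Rightarrow> real"
  where "smoothed \<delta> n X i b = \<delta> + (1 - 2 * \<delta>) * (\<Sum>j<n. of_bool ((X ! j) i = b)) / real n"

definition smoothed_prod :: "real \<Rightarrow> nat \<Rightarrow> nat \<Rightarrow> (nat \<Rightarrow> bool) list \<Rightarrow> (nat \<Rightarrow> bool) pmf"
  where "smoothed_prod \<delta> d n X = Pi_pmf {..<d} False (\<lambda>i. bernoulli_pmf (smoothed \<delta> n X i True))"

lemma smoothed_ge: "\<delta> \<le> 1 / 2 \<Longrightarrow> \<delta> \<le> smoothed \<delta> n X i b"
  unfolding smoothed_def by (auto intro!: divide_nonneg_nonneg mult_nonneg_nonneg sum_nonneg)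

lemma smoothed_False:
  assumes "n > 0"
  shows "smoothed \<delta> n X i False = 1 - smoothed \<delta> n X i True"
proof -
  have "(\<Sum>j<n. of_bool ((X ! j) i = False) :: real) + (\<Sum>j<n. of_bool ((X ! j) i = True))
      = (\<Sum>j<n. 1)"
    unfolding sum.distrib[symmetric] by (intro sum.cong) auto
  then have eq: "(\<Sum>j<n. of_bool ((X ! j) i = False) :: real) = real n - (\<Sum>j<n. of_bool ((X ! j) i = True))"
    by simp
  show ?thesis unfolding smoothed_def eq using assms by (simp add: field_simps)
qed

lemma pmf_bernoulli_smoothed:
  assumes "0 < \<delta>" "\<delta> \<le> 1 / 2" "n > 0"
  shows "pmf (bernoulli_pmf (smoothed \<delta> n X i True)) b = smoothed \<delta> n X i b"
  using smoothed_ge[OF assms(2), of n X i True] smoothed_ge[OF assms(2), of n X i False]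
    smoothed_False[OF assms(3), of \<delta> X i] assms(1)
  by (cases b) auto

lemma pmf_smoothed_prod:
  assumes "0 < \<delta>" "\<delta> \<le> 1 / 2" "n > 0" "y \<in> cube d"
  shows "pmf (smoothed_prod \<delta> d n X) y = (\<Prod>i<d. smoothed \<delta> n X i (y i))"
  unfolding smoothed_prod_def using assms(4)
  by (subst pmf_Pi) (auto simp: pmf_bernoulli_smoothed[OF assms(1-3)] cube_def PiE_dflt_def)

lemma set_smoothed_prod:
  assumes "0 < \<delta>" "\<delta> \<le> 1 / 2" "n > 0"
  shows "set_pmf (smoothed_prod \<delta> d n X) = cube d"
proof -
  have "set_pmf (bernoulli_pmf (smoothed \<delta> n X i True)) = UNIV" for i
    using pmf_bernoulli_smoothed[OF assms, of X i] smoothed_ge[OF assms(2), of n X i] assms(1)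
    by (auto simp: set_pmf_iff) (metis less_le_not_le)
  then show ?thesis unfolding smoothed_prod_def cube_def by (subst set_Pi_pmf) (auto simp: comp_def)
qed

lemma finite_cube: "finite (cube d)"
  unfolding cube_def by (rule finite_PiE_dflt) auto

lemma expectation_bool:
  fixes f :: "bool \<Rightarrow> real"
  shows "expect p f = f True * pmf p True + f False * pmf p False"
  by (subst integral_measure_pmf_real[of UNIV]) (auto simp: UNIV_bool)

lemma pmf_bool_add: "pmf p True + pmf p False = 1"
  using sum_pmf_eq_1[of UNIV p] by (simp add: UNIV_bool[symmetric]) (simp add: UNIV_bool add.commute)

lemma expectation_smoothed_prod:
  assumes "0 < \<delta>" "\<delta> \<le> 1 / 2" "n > 0" "y \<in> cube d"
  shows "expect (replicate_pmf n (Pi_pmf {..<d} False P)) (\<lambda>X. pmf (smoothed_prod \<delta> d n X) y)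
       = (\<Prod>i<d. \<delta> + (1 - 2 * \<delta>) * pmf (P i) (y i))"
proof -
  \<comment> \<open>The share of a single record in the smoothed frequency of \<open>y i\<close>;
    the floor \<delta> becomes the offset in \<open>expectation_prod_columns\<close>.\<close>
  define g where "g i b = (1 - 2 * \<delta>) / real n * of_bool (b = y i)" for i b
  have "pmf (smoothed_prod \<delta> d n X) y = (\<Prod>i<d. \<delta> + (\<Sum>j<n. g i ((X ! j) i)))" for X
    unfolding pmf_smoothed_prod[OF assms] smoothed_def g_def
    by (simp add: sum_distrib_left sum_divide_distrib
        del: sum_of_bool_eq sum_mult_of_bool_eq sum_of_bool_mult_eq)
  moreover have "real n * expect (P i) (g i) = (1 - 2 * \<delta>) * pmf (P i) (y i)" for i
    using assms(3) unfolding expectation_bool g_def by (cases "y i") auto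
  moreover have "expect (replicate_pmf n (Pi_pmf {..<d} False P)) (\<lambda>X. \<Prod>i<d. \<delta> + (\<Sum>j<n. g i ((X ! j) i)))
      = (\<Prod>i<d. \<delta> + real n * expect (P i) (g i))"
    using assms by (intro expectation_prod_columns) (auto simp: g_def)
  ultimately show ?thesis by simp
qed

text \<open>\<open>ratio_le_exp_weight\<close> in each coordinate, where the drop in frequency is
  charged to the changed records that carried the bit \<open>y i\<close>. Because \<open>m\<close>
  replaces the empirical frequencies, each charge depends on its own record only, and the exponent
  is free of \<open>y\<close>.\<close>

lemma smoothed_prod_ratio:
  fixes m :: "nat \<Rightarrow> bool \<Rightarrow> real" and X X' :: "(nat \<Rightarrow> bool) list"
  assumes \<delta>: "0 < \<delta>" "\<delta> \<le> 1 / 2" and n: "n > 0" and y: "y \<in> cube d"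
    and m: "\<And>i b. i < d \<Longrightarrow> \<delta> \<le> m i b" "\<And>i b. i < d \<Longrightarrow> m i b / 4 \<le> smoothed \<delta> n X i b"
  defines "T \<equiv> {j. j < n \<and> X ! j \<noteq> X' ! j}"
  shows "pmf (smoothed_prod \<delta> d n X) y
       \<le> exp ((\<Sum>j\<in>T. \<Sum>i<d. 4 * weight \<delta> (m i ((X ! j) i))) / real n)
         * pmf (smoothed_prod \<delta> d n X') y"
proof -
  define q where "q i = smoothed \<delta> n X i (y i)" for i
  define q' where "q' i = smoothed \<delta> n X' i (y i)" for i
  define t where "t i = (\<Sum>j\<in>T. of_bool ((X ! j) i = y i)) / real n" for i
  have finT: "finite T" "T \<subseteq> {..<n}" by (auto simp: T_def)
  have t0: "t i \<ge> 0" for i unfolding t_def by (intro divide_nonneg_nonneg sum_nonneg) auto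
  have q: "\<delta> \<le> q i" "\<delta> \<le> q' i" for i unfolding q_def q'_def using smoothed_ge \<delta> by auto
  have qt: "q i \<le> q' i + t i" for i
  proof -
    let ?c = "\<lambda>X. (\<Sum>j<n. of_bool ((X ! j) i = y i)) :: real"
    have "?c X \<le> (\<Sum>j<n. of_bool ((X' ! j) i = y i) + of_bool (j \<in> T) * of_bool ((X ! j) i = y i))"
      by (intro sum_mono) (auto simp: T_def)
    also have "\<dots> = ?c X' + (\<Sum>j\<in>T. of_bool ((X ! j) i = y i))"
      unfolding sum.distrib using finT
      by (intro arg_cong2[of _ _ _ _ "(+)"] sum.mono_neutral_cong_right refl) auto
    also have "(\<Sum>j\<in>T. of_bool ((X ! j) i = y i)) = real n * t i" using n by (simp add: t_def)
    finally have "(1 - 2 * \<delta>) * ?c X / real n \<le> (1 - 2 * \<delta>) * (?c X' + real n * t i) / real n"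
      using \<delta> by (intro divide_right_mono mult_left_mono) auto
    also have "\<dots> = (1 - 2 * \<delta>) * ?c X' / real n + (1 - 2 * \<delta>) * t i"
      using n by (simp add: field_simps)
    also have "(1 - 2 * \<delta>) * t i \<le> t i" using \<delta> t0[of i] by (simp add: mult_left_le_one_le)
    finally show ?thesis unfolding q_def q'_def smoothed_def by simp
  qed
  have le: "t i * weight \<delta> (q i)
      \<le> (\<Sum>j\<in>T. 4 * weight \<delta> (m i ((X ! j) i))) / real n" if "i < d" for i
  proof -
    \<comment> \<open>If record \<open>j\<close> has the bit \<open>y i\<close>, then
      \<open>q i\<close> is the frequency of its own bit; otherwise the left side is 0.\<close>
    have "of_bool ((X ! j) i = y i) * weight \<delta> (q i) \<le> 4 * weight \<delta> (m i ((X ! j) i))" for j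
      using weight_le_4[OF \<delta>(1) q(1)[of i] m(1)[OF that, of "y i"]] m(2)[OF that, of "y i"]
        weight_nonneg[OF \<delta>(1) m(1)[OF that, of "(X ! j) i"]]
      by (auto simp: q_def)
    then show ?thesis unfolding t_def
      by (simp add: sum_distrib_right divide_right_mono sum_mono)
  qed
  have "pmf (smoothed_prod \<delta> d n X) y = (\<Prod>i<d. q i)"
    unfolding pmf_smoothed_prod[OF \<delta> n y] q_def ..
  also have "\<dots> \<le> (\<Prod>i<d. q' i * exp (t i * weight \<delta> (q i)))"
  proof (intro prod_mono conjI)
    fix i
    show "0 \<le> q i" using q(1)[of i] \<delta> by simp
    show "q i \<le> q' i * exp (t i * weight \<delta> (q i))"
      using ratio_le_exp_weight[OF \<delta>(1) q qt t0] .
  qed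
  also have "\<dots> = exp (\<Sum>i<d. t i * weight \<delta> (q i)) * (\<Prod>i<d. q' i)"
    by (simp add: prod.distrib exp_sum)
  also have "\<dots> \<le> exp (\<Sum>i<d. (\<Sum>j\<in>T. 4 * weight \<delta> (m i ((X ! j) i))) / real n) * (\<Prod>i<d. q' i)"
  proof (intro mult_right_mono)
    show "(\<Prod>i<d. q' i) \<ge> 0" using q(2) \<delta> by (intro prod_nonneg) (auto intro: order_trans less_imp_le)
    show "exp (\<Sum>i<d. t i * weight \<delta> (q i)) \<le> exp (\<Sum>i<d. (\<Sum>j\<in>T. 4 * weight \<delta> (m i ((X ! j) i))) / real n)"
      using le by (auto intro!: sum_mono)
  qed
  also have "(\<Sum>i<d. (\<Sum>j\<in>T. 4 * weight \<delta> (m i ((X ! j) i))) / real n)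
      = (\<Sum>j\<in>T. \<Sum>i<d. 4 * weight \<delta> (m i ((X ! j) i))) / real n"
    unfolding sum_divide_distrib[symmetric] by (subst sum.swap) simp
  also have "(\<Prod>i<d. q' i) = pmf (smoothed_prod \<delta> d n X') y"
    unfolding pmf_smoothed_prod[OF \<delta> n y] q'_def ..
  finally show ?thesis .
qed

section \<open>Record costs, bit counts and the expected loss\<close>

text \<open>The weight of a record under the true bit probabilities, floored at \<delta>. The
  scaling by \<delta> puts every summand into the unit interval.\<close>

definition cost :: "real \<Rightarrow> nat \<Rightarrow> (nat \<Rightarrow> bool pmf) \<Rightarrow> (nat \<Rightarrow> bool) \<Rightarrow> real"
  where "cost \<delta> d P x = (\<Sum>i<d. \<delta> * weight \<delta> (max \<delta> (pmf (P i) (x i))))"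

text \<open>On the unit interval \<open>exp z \<le> 1 + 2 * z\<close>, so each coordinate needs only
  a bound on its mean. There the probability of a bit value cancels the denominator of its weight,
  leaving \<open>\<delta> * (1 + ln (1 / \<delta>))\<close> for each of the two values. Independence
  multiplies the coordinates.\<close>

lemma expectation_exp_cost:
  assumes \<delta>: "0 < \<delta>" "\<delta> \<le> 1"
  shows "expect (Pi_pmf {..<d} False P) (\<lambda>x. exp (cost \<delta> d P x))
       \<le> exp (4 * real d * \<delta> * (1 + ln (1 / \<delta>)))"
proof -
  define v where "v i b = \<delta> * weight \<delta> (max \<delta> (pmf (P i) b))" for i b
  define L where "L = \<delta> * (1 + ln (1 / \<delta>))"
  have v01: "0 \<le> v i b" "v i b \<le> 1" for i b
    unfolding v_def using weight_le_inverse[OF \<delta>(1)] weight_nonneg[OF \<delta>(1)] \<delta> by auto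
  have v_pmf: "v i b * pmf (P i) b \<le> L" for i b
  proof -
    let ?m = "max \<delta> (pmf (P i) b)"
    have "v i b * pmf (P i) b \<le> v i b * ?m" using v01 by (intro mult_left_mono) auto
    also have "\<dots> = \<delta> * (1 + ln (?m / \<delta>))" using \<delta> by (simp add: v_def weight_def)
    also have "\<dots> \<le> L" unfolding L_def using \<delta> pmf_le_1[of "P i" b]
      by (intro mult_left_mono add_left_mono ln_mono divide_right_mono) auto
    finally show ?thesis .
  qed
  have exp_le: "exp z \<le> 1 + 2 * z" if "0 \<le> z" "z \<le> 1" for z :: real
    using exp_bound[OF that] mult_left_le[OF that(2,1)] by (simp add: power2_eq_square)
  have one: "expect (P i) (\<lambda>b. exp (v i b)) \<le> exp (4 * L)" for i
  proof -
    have "expect (P i) (\<lambda>b. exp (v i b)) \<le> expect (P i) (\<lambda>b. 1 + 2 * v i b)"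
      by (intro expectation_mono_pmf) (auto intro: exp_le v01)
    also have "\<dots> = 1 + 2 * (v i True * pmf (P i) True + v i False * pmf (P i) False)"
      using pmf_bool_add[of "P i"] unfolding expectation_bool by (simp add: algebra_simps)
    also have "\<dots> \<le> 1 + 4 * L" using v_pmf[of i True] v_pmf[of i False] by simp
    also have "\<dots> \<le> exp (4 * L)" by (rule exp_ge_add_one_self)
    finally show ?thesis .
  qed
  have "expect (Pi_pmf {..<d} False P) (\<lambda>x. exp (cost \<delta> d P x))
      = expect (Pi_pmf {..<d} False P) (\<lambda>x. \<Prod>i<d. exp (v i (x i)))"
    unfolding cost_def v_def by (simp add: exp_sum)
  also have "\<dots> = (\<Prod>i<d. expect (P i) (\<lambda>b. exp (v i b)))"
    by (rule expectation_prod_Pi_pmf) auto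
  also have "\<dots> \<le> (\<Prod>i<d. exp (4 * L))"
    by (intro prod_mono conjI one integral_nonneg_AE) auto
  also have "\<dots> = exp (4 * real d * \<delta> * (1 + ln (1 / \<delta>)))"
    by (simp add: exp_of_nat_mult[symmetric] L_def algebra_simps)
  finally show ?thesis .
qed

text \<open>A Chernoff bound with parameter -1: one record contributes at most
  \<open>exp (- \<pi> / 2)\<close>, and \<open>n * \<pi> / 4\<close> of the resulting exponent is
  spent on the threshold.\<close>

lemma expectation_exp_count:
  fixes P :: "nat \<Rightarrow> bool pmf"
  assumes "i < d"
  shows "expect (replicate_pmf n (Pi_pmf {..<d} False P))
           (\<lambda>X. exp (real n * pmf (P i) b / 4 - (\<Sum>j<n. of_bool ((X ! j) i = b))))
       \<le> exp (- (real n * pmf (P i) b / 4))"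
proof -
  define \<pi> where "\<pi> = pmf (P i) b"
  let ?D = "Pi_pmf {..<d} False P"
  let ?f = "\<lambda>x::nat \<Rightarrow> bool. exp (- of_bool (x i = b)) :: real"
  have "2 \<le> exp (1::real)" using exp_ge_add_one_self[of 1] by simp
  then have e: "exp (- 1) \<le> (1 / 2 :: real)" by (simp add: exp_minus field_simps)
  have "expect ?D ?f = expect (map_pmf (\<lambda>x. x i) ?D) (\<lambda>c. exp (- of_bool (c = b)))"
    by simp
  also have "map_pmf (\<lambda>x. x i) ?D = P i" using assms by (subst Pi_pmf_component) auto
  also have "expect (P i) (\<lambda>c. exp (- of_bool (c = b))) = 1 - \<pi> * (1 - exp (- 1))"
    using pmf_bool_add[of "P i"] unfolding expectation_bool \<pi>_def
    by (cases b) (auto simp: algebra_simps)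
  also have "\<dots> \<le> 1 + (- \<pi> / 2)"
    using mult_left_mono[OF e, of \<pi>] by (simp add: \<pi>_def algebra_simps)
  also have "\<dots> \<le> exp (- \<pi> / 2)" by (rule exp_ge_add_one_self)
  finally have f: "expect ?D ?f \<le> exp (- \<pi> / 2)" .
  have "exp (real n * \<pi> / 4 - (\<Sum>j<n. of_bool ((X ! j) i = b)))
      = exp (real n * \<pi> / 4) * (\<Prod>j<n. ?f (X ! j))" for X :: "(nat \<Rightarrow> bool) list"
    by (subst exp_sum[symmetric])
       (simp_all add: exp_add[symmetric] sum_negf del: sum_of_bool_eq)
  then have "expect (replicate_pmf n ?D) (\<lambda>X. exp (real n * \<pi> / 4 - (\<Sum>j<n. of_bool ((X ! j) i = b))))
      = exp (real n * \<pi> / 4) * expect (replicate_pmf n ?D) (\<lambda>X. \<Prod>j<n. ?f (X ! j))"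
    by (simp del: sum_of_bool_eq)
  also have "\<dots> = exp (real n * \<pi> / 4) * expect ?D ?f ^ n"
    unfolding expectation_replicate_prod[where f = ?f, OF finite_set_Pi_bool_pmf] ..
  also have "\<dots> \<le> exp (real n * \<pi> / 4) * exp (- \<pi> / 2) ^ n"
    using f by (intro mult_left_mono power_mono integral_nonneg_AE) auto
  also have "\<dots> = exp (- (real n * \<pi> / 4))"
    by (simp add: exp_of_nat_mult[symmetric] exp_add[symmetric])
  finally show ?thesis unfolding \<pi>_def .
qed

text \<open>The first summand is at least 1 as soon as the count of some bit value of probability \<open>p \<ge> \<delta>\<close> is at
  most \<open>n * p / 4\<close>; the second one majorises the average excess of the record costs over \<open>K\<close>.\<close>
definition loss :: "real \<Rightarrow> real \<Rightarrow> nat \<Rightarrow> nat \<Rightarrow> (nat \<Rightarrow> bool pmf) \<Rightarrow> (nat \<Rightarrow> bool) list \<Rightarrow> real"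
  where "loss \<delta> K d n P X =
    (\<Sum>i<d. \<Sum>b\<in>UNIV. of_bool (\<delta> \<le> pmf (P i) b) *
       exp (real n * pmf (P i) b / 4 - (\<Sum>j<n. of_bool ((X ! j) i = b))))
    + (\<Sum>j<n. 4 / \<delta> * exp (cost \<delta> d P (X ! j) - K)) / real n"

lemma loss_nonneg: "0 < \<delta> \<Longrightarrow> 0 \<le> loss \<delta> K d n P X"
  unfolding loss_def by (intro add_nonneg_nonneg sum_nonneg divide_nonneg_nonneg) auto

text \<open>Each exponential in the first sum of \<open>loss\<close> is below 1, so its exponent is
  negative and the count exceeds a quarter of its mean. Rarer bit values are covered by the floor
  \<delta>.\<close>

lemma smoothed_ge_of_loss:
  assumes \<delta>: "0 < \<delta>" "\<delta> \<le> 1 / 2" and n: "n > 0" and i: "i < d" and loss: "loss \<delta> K d n P X < 1"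
  shows "max \<delta> (pmf (P i) b) / 4 \<le> smoothed \<delta> n X i b"
proof (cases "\<delta> \<le> pmf (P i) b")
  case True
  let ?\<pi> = "pmf (P i) b"
  let ?c = "\<Sum>j<n. of_bool ((X ! j) i = b) :: real"
  let ?g = "\<lambda>i b. of_bool (\<delta> \<le> pmf (P i) b) *
       exp (real n * pmf (P i) b / 4 - (\<Sum>j<n. of_bool ((X ! j) i = b))) :: real"
  have "exp (real n * ?\<pi> / 4 - ?c) = ?g i b" using True by simp
  also have "\<dots> \<le> (\<Sum>b\<in>UNIV. ?g i b)" by (intro member_le_sum) auto
  also have "\<dots> \<le> (\<Sum>i<d. \<Sum>b\<in>UNIV. ?g i b)"
    using i by (intro member_le_sum[of i "{..<d}" "\<lambda>i. \<Sum>b\<in>UNIV. ?g i b"]) (auto intro!: sum_nonneg)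
  also have "\<dots> \<le> loss \<delta> K d n P X"
    unfolding loss_def using \<delta> by (auto intro!: divide_nonneg_nonneg sum_nonneg)
  finally have "exp (real n * ?\<pi> / 4 - ?c) < 1" using loss by (rule le_less_trans)
  then have "?\<pi> / 4 \<le> ?c / real n"
    using n by (simp add: field_simps del: sum_of_bool_eq)
  then have "(1 - 2 * \<delta>) * (?\<pi> / 4) \<le> (1 - 2 * \<delta>) * (?c / real n)"
    using \<delta> by (intro mult_left_mono) auto
  \<comment> \<open>Shrinking by \<open>1 - 2 * \<delta>\<close> costs
    \<open>\<delta> * ?\<pi> / 2\<close>, which the added \<delta> outweighs.\<close>
  moreover have "?\<pi> / 4 \<le> \<delta> + (1 - 2 * \<delta>) * (?\<pi> / 4)"
  proof -
    have "\<delta> + (1 - 2 * \<delta>) * (?\<pi> / 4) = ?\<pi> / 4 + \<delta> - \<delta> * ?\<pi> / 2"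
      by (simp add: field_simps)
    moreover have "\<delta> * ?\<pi> \<le> \<delta> * 1" using \<delta> by (intro mult_left_mono pmf_le_1) auto
    ultimately show ?thesis using \<delta> by linarith
  qed
  ultimately show ?thesis using True unfolding smoothed_def by simp
next
  case False
  then show ?thesis using smoothed_ge[OF \<delta>(2), of n X i b] \<delta> by (simp add: max_def)
qed

text \<open>The factor \<open>1 - loss\<close> makes the bound unconditional: it is trivial once the
  loss reaches 1. Otherwise \<open>V \<le> K + exp (V - K)\<close> splits each cost: the
  \<open>K\<close> parts are absorbed by \<open>c\<close> per changed record, the excess by
  \<open>1 - ?l \<le> exp (- ?l)\<close>.\<close>

lemma smoothed_prod_loss:
  fixes X X' :: "(nat \<Rightarrow> bool) list"
  assumes \<delta>: "0 < \<delta>" "\<delta> \<le> 1 / 2" and n: "n > 0" and y: "y \<in> cube d"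
    and c: "4 * K / (\<delta> * real n) \<le> c"
  defines "T \<equiv> {j. j < n \<and> X ! j \<noteq> X' ! j}"
  shows "(1 - loss \<delta> K d n P X) * pmf (smoothed_prod \<delta> d n X) y
       \<le> exp (c * real (card T)) * pmf (smoothed_prod \<delta> d n X') y"
proof (cases "loss \<delta> K d n P X < 1")
  case False
  then have "(1 - loss \<delta> K d n P X) * pmf (smoothed_prod \<delta> d n X) y \<le> 0"
    by (simp add: mult_nonpos_nonneg)
  also have "0 \<le> exp (c * real (card T)) * pmf (smoothed_prod \<delta> d n X') y" by simp
  finally show ?thesis .
next
  case True
  let ?l = "loss \<delta> K d n P X"
  let ?V = "\<lambda>j. cost \<delta> d P (X ! j)"
  define A where "A = (\<Sum>j\<in>T. \<Sum>i<d. 4 * weight \<delta> (max \<delta> (pmf (P i) ((X ! j) i)))) / real n"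
  have T: "T \<subseteq> {..<n}" by (auto simp: T_def)
  have main: "pmf (smoothed_prod \<delta> d n X) y \<le> exp A * pmf (smoothed_prod \<delta> d n X') y"
    unfolding A_def T_def using smoothed_ge_of_loss[OF \<delta> n _ True]
    by (intro smoothed_prod_ratio[OF \<delta> n y]) auto
  have "A = (\<Sum>j\<in>T. 4 / \<delta> * ?V j) / real n"
    unfolding A_def cost_def using \<delta> by (simp add: sum_distrib_left)
  also have "\<dots> \<le> (\<Sum>j\<in>T. 4 / \<delta> * K + 4 / \<delta> * exp (?V j - K)) / real n"
  proof (intro divide_right_mono sum_mono)
    fix j
    have "?V j \<le> K + exp (?V j - K)" using exp_ge_add_one_self[of "?V j - K"] by linarith
    then show "4 / \<delta> * ?V j \<le> 4 / \<delta> * K + 4 / \<delta> * exp (?V j - K)"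
      using \<delta> unfolding distrib_left[symmetric] by (intro mult_left_mono) auto
  qed simp
  also have "\<dots> = 4 * K / (\<delta> * real n) * real (card T) + (\<Sum>j\<in>T. 4 / \<delta> * exp (?V j - K)) / real n"
    by (simp add: sum.distrib add_divide_distrib)
  also have "\<dots> \<le> c * real (card T) + ?l"
  proof (intro add_mono mult_right_mono c)
    \<comment> \<open>Summing the excess over all records instead of \<open>T\<close> gives a bound
      that holds for every \<open>X'\<close> at once.\<close>
    have "(\<Sum>j\<in>T. 4 / \<delta> * exp (?V j - K)) / real n \<le> (\<Sum>j<n. 4 / \<delta> * exp (?V j - K)) / real n"
      using T \<delta> by (intro divide_right_mono sum_mono2) auto
    also have "\<dots> \<le> ?l" unfolding loss_def by (auto intro!: sum_nonneg)
    finally show "(\<Sum>j\<in>T. 4 / \<delta> * exp (?V j - K)) / real n \<le> ?l" .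
  qed simp
  finally have A: "A \<le> c * real (card T) + ?l" .
  have "(1 - ?l) * pmf (smoothed_prod \<delta> d n X) y \<le> exp (- ?l) * (exp A * pmf (smoothed_prod \<delta> d n X') y)"
    using exp_ge_add_one_self[of "- ?l"] True by (intro mult_mono main) auto
  also have "\<dots> = exp (A - ?l) * pmf (smoothed_prod \<delta> d n X') y"
    by (simp add: exp_diff exp_minus field_simps)
  also have "\<dots> \<le> exp (c * real (card T)) * pmf (smoothed_prod \<delta> d n X') y"
    using A by (intro mult_right_mono) auto
  finally show ?thesis .
qed

text \<open>The guard in \<open>loss\<close> lets \<delta> replace the probability in each of the
  \<open>2 * d\<close> count bounds. The average excess over the records has the expectation of a
  single record, so \<open>n\<close> cancels.\<close>

lemma expectation_loss:
  assumes \<delta>: "0 < \<delta>" "\<delta> \<le> 1" and n: "n > 0"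
  shows "expect (replicate_pmf n (Pi_pmf {..<d} False P)) (loss \<delta> K d n P)
       \<le> 2 * real d * exp (- (real n * \<delta> / 4))
         + 4 / \<delta> * exp (4 * real d * \<delta> * (1 + ln (1 / \<delta>)) - K)"
proof -
  let ?D = "Pi_pmf {..<d} False P"
  let ?R = "replicate_pmf n ?D"
  let ?g = "\<lambda>i b X. exp (real n * pmf (P i) b / 4 - (\<Sum>j<n. of_bool ((X ! j) i = b))) :: real"
  have "expect ?R (loss \<delta> K d n P)
      = (\<Sum>i<d. \<Sum>b\<in>UNIV. of_bool (\<delta> \<le> pmf (P i) b) * expect ?R (?g i b))
      + expect ?R (\<lambda>X. \<Sum>j<n. 4 / \<delta> * exp (cost \<delta> d P (X ! j) - K)) / real n"
    unfolding loss_def by (simp add: integrable_sum)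
  also have "expect ?R (\<lambda>X. \<Sum>j<n. 4 / \<delta> * exp (cost \<delta> d P (X ! j) - K)) / real n
      = 4 / \<delta> * exp (- K) * expect ?D (\<lambda>x. exp (cost \<delta> d P x))"
    using n by (subst expectation_replicate_sum) (auto simp: exp_diff exp_minus field_simps)
  also have "\<dots> \<le> 4 / \<delta> * exp (- K) * exp (4 * real d * \<delta> * (1 + ln (1 / \<delta>)))"
    using \<delta> by (intro mult_left_mono expectation_exp_cost) auto
  also have "\<dots> = 4 / \<delta> * exp (4 * real d * \<delta> * (1 + ln (1 / \<delta>)) - K)"
    by (simp add: exp_diff exp_minus field_simps)
  also have "(\<Sum>i<d. \<Sum>b\<in>UNIV. of_bool (\<delta> \<le> pmf (P i) b) * expect ?R (?g i b))
      \<le> (\<Sum>i<d. \<Sum>b\<in>(UNIV::bool set). exp (- (real n * \<delta> / 4)))"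
  proof (intro sum_mono)
    fix i and b :: bool assume i: "i \<in> {..<d}"
    show "of_bool (\<delta> \<le> pmf (P i) b) * expect ?R (?g i b) \<le> exp (- (real n * \<delta> / 4))"
    proof (cases "\<delta> \<le> pmf (P i) b")
      case True
      have "expect ?R (?g i b) \<le> exp (- (real n * pmf (P i) b / 4))"
        using i by (intro expectation_exp_count) simp
      also have "\<dots> \<le> exp (- (real n * \<delta> / 4))" using True by (simp add: mult_left_mono)
      finally show ?thesis using True by simp
    qed simp
  qed
  also have "\<dots> = 2 * real d * exp (- (real n * \<delta> / 4))" by simp
  finally show ?thesis by simp
qed

section \<open>Accuracy of a mechanism that dominates the smoothed product up to the loss\<close>

lemma prob_eq_sum:
  assumes "finite \<Omega>" "set_pmf p \<subseteq> \<Omega>"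
  shows "measure_pmf.prob p S = (\<Sum>y\<in>S \<inter> \<Omega>. pmf p y)"
proof -
  have "measure_pmf.prob p S = measure_pmf.prob p (S \<inter> \<Omega>)"
    using assms(2) by (intro measure_prob_cong_0) (auto simp: pmf_eq_0_set_pmf)
  then show ?thesis using assms(1) by (simp add: measure_measure_pmf_finite)
qed

text \<open>Averaging \<open>low\<close> over the data compares the output with the mean of the
  smoothed product. The deficit sums over \<open>y\<close> to at most the expected loss, because the
  smoothed product has total mass 1; the rest is smoothing bias.\<close>

lemma product_accurate:
  fixes P :: "nat \<Rightarrow> bool pmf" and M :: "(nat \<Rightarrow> bool) list \<Rightarrow> (nat \<Rightarrow> bool) pmf"
  assumes \<delta>: "0 < \<delta>" "\<delta> \<le> 1 / 2" and n: "n > 0"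
    and M: "\<And>X. set_pmf (M X) \<subseteq> cube d"
    and low: "\<And>X y. X \<in> datasets (cube d) n \<Longrightarrow> y \<in> cube d \<Longrightarrow>
      (1 - loss \<delta> K d n P X) * pmf (smoothed_prod \<delta> d n X) y \<le> pmf (M X) y"
  defines "D \<equiv> Pi_pmf {..<d} False P"
  shows "dtv D (output_dist n M D)
      \<le> 2 * real d * \<delta> + expect (replicate_pmf n D) (loss \<delta> K d n P)"
proof (rule dtv_le)
  fix S
  let ?R = "replicate_pmf n D"
  let ?f = "\<lambda>y X. pmf (smoothed_prod \<delta> d n X) y"
  let ?l = "loss \<delta> K d n P"
  let ?S = "S \<inter> cube d"
  have fin: "finite (set_pmf ?R)" by (simp add: D_def)
  have D: "set_pmf D \<subseteq> cube d"
    unfolding D_def cube_def by (rule order_trans[OF set_Pi_pmf_subset']) (auto simp: PiE_dflt_def)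
  have R: "set_pmf ?R \<subseteq> datasets (cube d) n"
    using D by (auto simp: set_replicate_pmf datasets_def)
  have bias: "(1 - 2 * real d * \<delta>) * pmf D y \<le> expect ?R (?f y)" if y: "y \<in> cube d" for y
  proof -
    have pmfD: "pmf D y = (\<Prod>i<d. pmf (P i) (y i))"
      unfolding D_def using y by (subst pmf_Pi) (auto simp: cube_def PiE_dflt_def)
    \<comment> \<open>Bernoulli's inequality turns the \<open>d\<close> shrinking factors into a
      linear bias.\<close>
    have "1 + real d * (- (2 * \<delta>)) \<le> (1 + (- (2 * \<delta>))) ^ d"
      using \<delta> by (intro Bernoulli_inequality) auto
    then have "(1 - 2 * real d * \<delta>) * pmf D y \<le> (1 - 2 * \<delta>) ^ d * pmf D y"
      by (intro mult_right_mono) (auto simp: algebra_simps)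
    also have "\<dots> = (\<Prod>i<d. (1 - 2 * \<delta>) * pmf (P i) (y i))"
      by (simp add: pmfD prod.distrib)
    also have "\<dots> \<le> (\<Prod>i<d. \<delta> + (1 - 2 * \<delta>) * pmf (P i) (y i))"
      using \<delta> by (intro prod_mono) auto
    also have "\<dots> = expect ?R (?f y)"
      unfolding D_def by (rule expectation_smoothed_prod[OF \<delta> n y, symmetric])
    finally show ?thesis .
  qed
  have out: "set_pmf (output_dist n M D) \<subseteq> cube d" using M by (auto simp: output_dist_def)
  have lower: "expect ?R (?f y) - expect ?R (\<lambda>X. ?l X * ?f y X) \<le> pmf (output_dist n M D) y"
    if y: "y \<in> cube d" for y
  proof -
    have "expect ?R (?f y) - expect ?R (\<lambda>X. ?l X * ?f y X) = expect ?R (\<lambda>X. (1 - ?l X) * ?f y X)"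
      using fin by (simp add: algebra_simps)
    also have "\<dots> \<le> expect ?R (\<lambda>X. pmf (M X) y)"
      using low[OF _ y] R by (intro expectation_mono_pmf fin) auto
    also have "\<dots> = pmf (output_dist n M D) y" by (simp add: output_dist_def pmf_bind)
    finally show ?thesis .
  qed
  have "(1 - 2 * real d * \<delta>) * measure_pmf.prob D S \<le> (\<Sum>y\<in>?S. expect ?R (?f y))"
    unfolding prob_eq_sum[OF finite_cube D] sum_distrib_left using bias by (intro sum_mono) auto
  also have "\<dots> = (\<Sum>y\<in>?S. expect ?R (?f y) - expect ?R (\<lambda>X. ?l X * ?f y X))
      + expect ?R (\<lambda>X. \<Sum>y\<in>?S. ?l X * ?f y X)"
    using fin by (simp add: sum_subtractf)
  also have "\<dots> \<le> measure_pmf.prob (output_dist n M D) S + expect ?R ?l"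
  proof (rule add_mono)
    show "(\<Sum>y\<in>?S. expect ?R (?f y) - expect ?R (\<lambda>X. ?l X * ?f y X)) \<le> measure_pmf.prob (output_dist n M D) S"
      unfolding prob_eq_sum[OF finite_cube out] using lower by (intro sum_mono) auto
    show "expect ?R (\<lambda>X. \<Sum>y\<in>?S. ?l X * ?f y X) \<le> expect ?R ?l"
    proof (rule expectation_mono_pmf[OF fin])
      fix X
      have "(\<Sum>y\<in>?S. ?f y X) \<le> 1"
        using measure_pmf.prob_le_1[of "smoothed_prod \<delta> d n X" ?S] finite_cube
        by (simp add: measure_measure_pmf_finite)
      then show "(\<Sum>y\<in>?S. ?l X * ?f y X) \<le> ?l X"
        unfolding sum_distrib_left[symmetric] using loss_nonneg[OF \<delta>(1)] by (simp add: mult_left_le)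
    qed
  qed
  finally have "(1 - 2 * real d * \<delta>) * measure_pmf.prob D S
      \<le> measure_pmf.prob (output_dist n M D) S + expect ?R ?l" .
  moreover have "2 * real d * \<delta> * measure_pmf.prob D S \<le> 2 * real d * \<delta>"
    using \<delta> by (intro mult_left_le) auto
  ultimately show "measure_pmf.prob D S
      \<le> measure_pmf.prob (output_dist n M D) S + (2 * real d * \<delta> + expect ?R ?l)"
    by (simp add: left_diff_distrib)
qed

section \<open>Choice of parameters and assembly\<close>

text \<open>With \<open>K = 1 + ln (1 / \<delta>)\<close>,
  \<open>exp (- K) \<le> \<delta> / 2\<close>. The mean cost exponent is
  \<open>\<alpha> * K \<le> K\<close>, so the threshold \<open>3 * K\<close> leaves
  \<open>exp (- 2 * K)\<close>, small enough to beat the prefactor \<open>4 / \<delta>\<close>.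
  Counts and costs each use at most \<open>\<alpha> / 4\<close>.\<close>

lemma loss_bound:
  fixes d :: nat and \<alpha> :: real
  assumes d: "d \<ge> 1" and \<alpha>: "0 < \<alpha>" "\<alpha> \<le> 1 / 2"
  defines "\<delta> \<equiv> \<alpha> / (4 * real d)"
  assumes n: "24 * (1 + ln (1 / \<delta>)) / \<delta> \<le> real n"
  shows "expect (replicate_pmf n (Pi_pmf {..<d} False P)) (loss \<delta> (3 * (1 + ln (1 / \<delta>))) d n P)
       \<le> \<alpha> / 2"
proof -
  define K where "K = 1 + ln (1 / \<delta>)"
  have \<delta>: "0 < \<delta>" "\<delta> \<le> 1" "4 * real d * \<delta> = \<alpha>"
    unfolding \<delta>_def using d \<alpha> by (auto simp: divide_simps)
  have K: "K \<ge> 1" using \<delta> by (simp add: K_def)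
  have n\<delta>: "K \<le> real n * \<delta> / 4" using n \<delta> K by (simp add: K_def[symmetric] field_simps)
  then have n0: "n > 0" using K by (cases n) auto
  have "2 \<le> exp (1::real)" using exp_ge_add_one_self[of 1] by simp
  then have eK: "exp (- K) \<le> \<delta> / 2"
    using \<delta> by (simp add: K_def exp_minus exp_add exp_diff ln_div field_simps)
  have *: "expect (replicate_pmf n (Pi_pmf {..<d} False P)) (loss \<delta> (3 * K) d n P)
      \<le> 2 * real d * exp (- (real n * \<delta> / 4)) + 4 / \<delta> * exp (\<alpha> * K - 3 * K)"
    using expectation_loss[OF \<delta>(1,2) n0, of d P "3 * K"] by (simp add: \<delta>(3) K_def)
  have "exp (- (real n * \<delta> / 4)) \<le> \<delta> / 2"
    using n\<delta> eK by (meson exp_le_cancel_iff neg_le_iff_le order_trans)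
  then have "2 * real d * exp (- (real n * \<delta> / 4)) \<le> 2 * real d * (\<delta> / 2)"
    by (intro mult_left_mono) auto
  also have "\<dots> = \<alpha> / 4" using \<delta>(3) by simp
  finally have 1: "2 * real d * exp (- (real n * \<delta> / 4)) \<le> \<alpha> / 4" .
  have "\<alpha> * K \<le> 1 * K" using \<alpha> K by (intro mult_right_mono) auto
  then have "exp (\<alpha> * K - 3 * K) \<le> exp (- K) * exp (- K)"
    unfolding exp_add[symmetric] by simp
  also have "\<dots> \<le> \<delta> / 2 * (\<delta> / 2)" using eK \<delta> by (intro mult_mono) auto
  finally have "4 / \<delta> * exp (\<alpha> * K - 3 * K) \<le> 4 / \<delta> * (\<delta> / 2 * (\<delta> / 2))"
    using \<delta> by (intro mult_left_mono) auto
  also have "\<dots> = \<delta>" using \<delta> by simp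
  also have "\<delta> \<le> \<alpha> / 4" unfolding \<delta>_def using d \<alpha> by (simp add: field_simps)
  finally show ?thesis using * 1 unfolding K_def by linarith
qed

text \<open>Since \<open>d / \<alpha> \<ge> 2\<close>, the logarithm \<open>L\<close> is at least
  \<open>2 / 3\<close> and absorbs additive constants. The main term costs
  \<open>24 * 5 * 4 = 480\<close>; the slack of 20 covers the 1 from rounding up.\<close>

lemma sample_size_bound:
  fixes d :: nat and \<alpha> \<epsilon> :: real
  assumes d: "d \<ge> 1" and \<alpha>: "0 < \<alpha>" "\<alpha> \<le> 1 / 2" and \<epsilon>: "0 < \<epsilon>" "\<epsilon> \<le> 1"
  defines "\<delta> \<equiv> \<alpha> / (4 * real d)"
  shows "24 * (1 + ln (1 / \<delta>)) / (\<delta> * \<epsilon>) + 1 \<le> 500 * (real d * ln (real d / \<alpha>) / (\<alpha> * \<epsilon>))"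
proof -
  define L where "L = ln (real d / \<alpha>)"
  have "2 \<le> real d / \<alpha>" using d \<alpha> by (simp add: field_simps)
  then have "ln 2 \<le> L" unfolding L_def by (intro ln_mono) auto
  moreover have "ln 2 \<ge> (2 / 3 :: real)" by (rule ln2_ge_two_thirds)
  moreover have "ln 4 = 2 * ln (2::real)" using ln_realpow[of "2::real" 2] by simp
  moreover have "ln (1 / \<delta>) = ln 4 + L"
    unfolding \<delta>_def L_def using d \<alpha> by (simp add: ln_div ln_mult)
  ultimately have K: "1 + ln (1 / \<delta>) \<le> 5 * L" and L: "1 \<le> 2 * L" by linarith+
  define W where "W = real d * L / (\<alpha> * \<epsilon>)"
  have "24 * (1 + ln (1 / \<delta>)) / (\<delta> * \<epsilon>) \<le> 24 * (5 * L) / (\<delta> * \<epsilon>)"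
    using K d \<alpha> \<epsilon> by (intro divide_right_mono mult_left_mono) (auto simp: \<delta>_def)
  also have "\<dots> = 480 * W" using d by (simp add: \<delta>_def W_def)
  finally have "24 * (1 + ln (1 / \<delta>)) / (\<delta> * \<epsilon>) \<le> 480 * W" .
  moreover have "L \<le> W"
  proof -
    have "\<alpha> * \<epsilon> \<le> 1" using \<alpha> \<epsilon> by (intro mult_le_one) auto
    moreover have "1 * L \<le> real d * L" using d L by (intro mult_right_mono) auto
    ultimately have "L / 1 \<le> W"
      unfolding W_def using \<alpha> \<epsilon> L by (intro frac_le) auto
    then show ?thesis by simp
  qed
  ultimately have "24 * (1 + ln (1 / \<delta>)) / (\<delta> * \<epsilon>) + 1 \<le> 500 * W"
    using L by argo
  then show ?thesis unfolding W_def L_def .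
qed

theorem theorem7:
  shows "\<exists>C::real. C > 0 \<and>
    (\<forall>(d::nat) (\<epsilon>::real) (\<alpha>::real).
       d \<ge> 1 \<longrightarrow> \<epsilon> \<in> {0<..1} \<longrightarrow> \<alpha> \<in> {0<..1/2} \<longrightarrow>
       (\<exists>(n::nat) A.
          real n \<le> C * (real d * ln (real d / \<alpha>) / (\<alpha> * \<epsilon>) + real d * (ln (real d / \<alpha>))\<^sup>2 / \<epsilon>) \<and>
          sampler (cube d) n A \<and>
          pure_dp \<epsilon> (cube d) n A \<and>
          accurate \<alpha> (product_class d) n A))"
proof (intro exI[of _ "500::real"] conjI allI impI)
  fix d :: nat and \<epsilon> \<alpha> :: real
  assume d: "d \<ge> 1" and "\<epsilon> \<in> {0<..1}" and "\<alpha> \<in> {0<..1/2}"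
  then have \<epsilon>: "0 < \<epsilon>" "\<epsilon> \<le> 1" and \<alpha>: "0 < \<alpha>" "\<alpha> \<le> 1 / 2" by auto
  define \<delta> where "\<delta> = \<alpha> / (4 * real d)"
  define K where "K = 1 + ln (1 / \<delta>)"
  \<comment> \<open>Threshold \<open>3 * K\<close> times the scaling \<open>4 / \<delta>\<close>
    costs \<open>12 * K / (\<delta> * n)\<close> per changed record; 24 makes this at most
    \<open>\<epsilon> / 2\<close>.\<close>
  define n where "n = nat \<lceil>24 * K / (\<delta> * \<epsilon>)\<rceil>"
  have \<delta>: "0 < \<delta>" "\<delta> \<le> 1 / 2" "2 * real d * \<delta> = \<alpha> / 2"
    unfolding \<delta>_def using d \<alpha> by (auto simp: divide_simps)
  have K: "K \<ge> 1" using \<delta> by (simp add: K_def)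
  have pos: "24 * K / (\<delta> * \<epsilon>) > 0" using K \<delta> \<epsilon> by simp
  then have n_ge: "24 * K / (\<delta> * \<epsilon>) \<le> real n" and n: "n > 0"
    unfolding n_def by linarith+
  have n_le: "real n \<le> 24 * K / (\<delta> * \<epsilon>) + 1" using pos unfolding n_def by linarith
  have priv: "4 * (3 * K) / (\<delta> * real n) \<le> \<epsilon> / 2"
    using n_ge n \<delta> \<epsilon> by (simp add: field_simps)
  \<comment> \<open>As \<open>\<epsilon> \<le> 1\<close>, the sample size chosen for privacy also
    meets the requirement of \<open>loss_bound\<close>.\<close>
  have "24 * K / \<delta> \<le> 24 * K / (\<delta> * \<epsilon>)"
    using K \<delta> \<epsilon> by (intro divide_left_mono) (auto simp: mult_left_le)
  then have n_ge': "24 * K / \<delta> \<le> real n" using n_ge by linarith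
  \<comment> \<open>Counting only positions below \<open>n\<close> gives a Hamming distance whose
    laws hold for all lists, as the extension lemma demands.\<close>
  define h where "h X Y = real (card {j. j < n \<and> X ! j \<noteq> Y ! j})" for X Y :: "(nat \<Rightarrow> bool) list"
  have fin: "finite (datasets (cube d) n)"
    using finite_lists_length_eq[OF finite_cube, of d n] by (simp add: datasets_def conj_commute)
  have "replicate n (\<lambda>_. False) \<in> datasets (cube d) n"
    by (auto simp: datasets_def cube_def PiE_dflt_def)
  then have ne: "datasets (cube d) n \<noteq> {}" by auto
  have tri: "h X Z \<le> h X Y + h Y Z" for X Y Z
  proof -
    have "card {j. j < n \<and> X ! j \<noteq> Z ! j}
        \<le> card ({j. j < n \<and> X ! j \<noteq> Y ! j} \<union> {j. j < n \<and> Y ! j \<noteq> Z ! j})"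
      by (intro card_mono) auto
    also have "\<dots> \<le> card {j. j < n \<and> X ! j \<noteq> Y ! j} + card {j. j < n \<and> Y ! j \<noteq> Z ! j}"
      by (rule card_Un_le)
    finally show ?thesis unfolding h_def by linarith
  qed
  have sym: "h X Y = h Y X" for X Y
    unfolding h_def by (intro arg_cong[where f = "\<lambda>A. real (card A)"]) auto
  have refl: "h X X = 0" for X by (simp add: h_def)
  \<comment> \<open>Half of \<epsilon>, because normalising doubles the Lipschitz constant.\<close>
  have c: "0 \<le> \<epsilon> / 2" using \<epsilon> by simp
  obtain M where M: "\<And>X. set_pmf (M X) \<subseteq> cube d"
    and lip: "\<And>X Y y. pmf (M X) y \<le> exp (2 * (\<epsilon> / 2) * h X Y) * pmf (M Y) y"
    and low: "\<And>X y l. X \<in> datasets (cube d) n \<Longrightarrow> \<forall>X'\<in>datasets (cube d) n.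
        l \<le> exp (\<epsilon> / 2 * h X X') * pmf (smoothed_prod \<delta> d n X') y \<Longrightarrow> l \<le> pmf (M X) y"
    by (rule lipschitz_extension[where c = "\<epsilon> / 2" and F = "smoothed_prod \<delta> d n" and h = h,
          OF fin ne finite_cube set_smoothed_prod[OF \<delta>(1,2) n] tri sym refl c])
       (rule that)
  have "sampler (cube d) n M" using M by (simp add: sampler_def)
  moreover have "pure_dp \<epsilon> (cube d) n M"
    unfolding pure_dp_def
  proof (intro ballI impI allI)
    fix Y Y' S assume Y: "Y \<in> datasets (cube d) n" and "neighbors Y Y'"
    then have "h Y Y' = 1" by (auto simp: h_def neighbors_def datasets_def)
    then show "measure_pmf.prob (M Y) S \<le> exp \<epsilon> * measure_pmf.prob (M Y') S"
      unfolding prob_eq_sum[OF finite_cube M] sum_distrib_left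
      using lip[of Y _ Y'] by (intro sum_mono) simp
  qed
  moreover have "accurate \<alpha> (product_class d) n M"
    unfolding accurate_def
  proof
    fix D assume "D \<in> product_class d"
    then obtain P where D: "D = Pi_pmf {..<d} False P" unfolding product_class_def by auto
    \<comment> \<open>\<open>M\<close> was built without \<open>P\<close>, which enters only through
      this lower bound; hence one mechanism serves the whole class.\<close>
    have "(1 - loss \<delta> (3 * K) d n P X) * pmf (smoothed_prod \<delta> d n X) y \<le> pmf (M X) y"
      if "X \<in> datasets (cube d) n" "y \<in> cube d" for X y
      using smoothed_prod_loss[OF \<delta>(1,2) n that(2) priv] by (intro low that(1)) (simp add: h_def)
    then have "dtv D (output_dist n M D)
        \<le> 2 * real d * \<delta> + expect (replicate_pmf n D) (loss \<delta> (3 * K) d n P)"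
      unfolding D by (rule product_accurate[OF \<delta>(1,2) n M])
    also have "\<dots> \<le> \<alpha> / 2 + \<alpha> / 2"
      using loss_bound[OF d \<alpha>, of n P] n_ge' \<delta>(3) by (simp add: D K_def \<delta>_def)
    finally show "dtv D (output_dist n M D) \<le> \<alpha>" by simp
  qed
  moreover have "real n \<le> 500 * (real d * ln (real d / \<alpha>) / (\<alpha> * \<epsilon>) + real d * (ln (real d / \<alpha>))\<^sup>2 / \<epsilon>)"
  proof -
    have "0 \<le> real d * (ln (real d / \<alpha>))\<^sup>2 / \<epsilon>" using \<epsilon> by simp
    then show ?thesis
      using n_le sample_size_bound[OF d \<alpha> \<epsilon>] unfolding K_def \<delta>_def by (simp add: distrib_left)
  qed
  ultimately show "\<exists>n A. real n \<le> 500 * (real d * ln (real d / \<alpha>) / (\<alpha> * \<epsilon>) + real d * (ln (real d / \<alpha>))\<^sup>2 / \<epsilon>) \<and>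
      sampler (cube d) n A \<and> pure_dp \<epsilon> (cube d) n A \<and> accurate \<alpha> (product_class d) n A"
    by blast
qed simp

end
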